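(* Let $0 \le \alpha < 1$ and let $g \in \Sigma^*(\alpha)$ be given by the series $$g(z) = z + b_0 + \frac{b_1}{z} + \frac{b_2}{z^2} + \cdots, \qquad 1 < |z| < \infty .$$ Then $$|b_m| \le \frac{2(1-\alpha)}{m+1}, \qquad m = 0,1,2,\dots$$ The estimate is sharp: for every $0 \le \alpha < 1$ and every integer $m \ge 0$ there is a function $g \in \Sigma^*(\alpha)$ for which equality holds.
   Context: Let $V = \{z \in \mathbb{C} : 1 < |z| < \infty\}$. $\Sigma$ is the class of functions $g$ analytic and univalent in $V$ having a Laurent expansion of the form $g(z) = z + b_0 + \frac{b_1}{z} + \frac{b_2}{z^2} + \cdots$ in $V$. For $0 \le \alpha < 1$, $\Sigma^*(\alpha)$ (starlike functions of order $\alpha$ in $V$) is the class of $g \in \Sigma$ satisfying $\operatorname{Re}\left(\frac{z g'(z)}{g(z)}\right) > \alpha$ for all $z \in V$ (in particular $g$ has no zeros in $V$). *)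

theory Defs
  imports "HOL-Complex_Analysis.Complex_Analysis"
begin

definition exterior_disc :: "complex set" where
  "exterior_disc = {z. 1 < norm z}"

(* g(z) = z + b 0 + b 1 / z + b 2 / z^2 + ... at every point of the exterior disc. *)
definition has_exterior_expansion :: "(complex \<Rightarrow> complex) \<Rightarrow> (nat \<Rightarrow> complex) \<Rightarrow> bool" where
  "has_exterior_expansion g b \<longleftrightarrow>
     (\<forall>z\<in>exterior_disc. (\<lambda>n. b n / z ^ n) sums (g z - z))"

(* Elements are total functions; only their values on the exterior disc matter. *)
definition class_Sigma :: "(complex \<Rightarrow> complex) set" where
  "class_Sigma = {g. g analytic_on exterior_disc \<and> inj_on g exterior_disc \<and>
                     (\<exists>b. has_exterior_expansion g b)}"

(* The quotient is only meaningful where g does not vanish, so this is required explicitly. *)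
definition class_Sigma_star :: "real \<Rightarrow> (complex \<Rightarrow> complex) set" where
  "class_Sigma_star \<alpha> = {g \<in> class_Sigma.
     \<forall>z\<in>exterior_disc. g z \<noteq> 0 \<and> Re (z * deriv g z / g z) > \<alpha>}"

end

(* Coefficient bound (Clunie's method): Re (z g'/g) > \<alpha> says that the quotient
   w = (z g' - g) / (z g' + (1 - 2 \<alpha>) g) has modulus less than 1, and w vanishes at infinity.
   Comparing coefficients in z g' - g = w (z g' + (1 - 2 \<alpha>) g), truncating, and integrating
   over circles gives
     sum_{n<=m} (n+1)^2 |b_n|^2 <= 4 (1-\<alpha>)^2 + sum_{n<m} (n-1+2\<alpha>)^2 |b_n|^2,
   and the sum on the right is dominated termwise by the one on the left.
   Sharpness: g(z) = z (1 + z^(-k))^c with k = m + 1 and c = 2 (1-\<alpha>) / k. In the logarithmic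
   coordinate z = exp s it becomes s + c Ln (1 + exp (-k s)), whose derivative z g'/g has
   positive real part on the convex half plane Re s > 0, so g is injective. *)
theory Submission
  imports Defs
begin

section \<open>Fourier coefficients and Bessel's inequality on circles about 0\<close>

text \<open>Cauchy's formula for the n-th derivative at 0: with u = \<open>circlepath 0 r t\<close>
  one has du = 2 pi i u dt, and u * cnj u = r^2 turns r^(2n) / u^n into cnj (u^n).\<close>

lemma circle_coefficient_has_integral:
  assumes "f holomorphic_on ball 0 1" "f has_fps_expansion F" "0 < r" "r < 1"
  shows "((\<lambda>t. f (circlepath 0 r t) * cnj (circlepath 0 r t ^ n))
           has_integral fps_nth F n * of_real (r ^ (2 * n))) {0..1}"
proof -
  define c where "c = circlepath 0 r"
  have c: "norm (c t) = r" for t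
    using assms by (simp add: c_def circlepath norm_mult)
  have c0: "c t \<noteq> 0" for t
    using c[of t] assms by auto
  have vd: "vector_derivative c (at t) = 2 * pi * \<i> * c t" for t
    unfolding c_def vector_derivative_circlepath by (simp add: circlepath)
  have F: "fps_nth F n = (deriv ^^ n) f 0 / fact n"
    using assms fps_nth_fps_expansion by blast
  have "((\<lambda>u. f u / (u - 0) ^ Suc n) has_contour_integral
          (2 * pi * \<i>) / fact n * (deriv ^^ n) f 0) c"
    unfolding c_def
    using assms
    by (intro Cauchy_has_contour_integral_higher_derivative_circlepath
          holomorphic_on_imp_continuous_on holomorphic_on_subset[OF assms(1)]) auto
  then have "((\<lambda>t. f (c t) / c t ^ Suc n * (2 * pi * \<i> * c t)) has_integral
          (2 * pi * \<i>) * fps_nth F n) {0..1}"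
    by (simp add: has_contour_integral vd F)
  then have "((\<lambda>t. f (c t) / c t ^ Suc n * (2 * pi * \<i> * c t) * (of_real (r ^ (2 * n)) / (2 * pi * \<i>)))
      has_integral (2 * pi * \<i>) * fps_nth F n * (of_real (r ^ (2 * n)) / (2 * pi * \<i>))) {0..1}"
    by (rule has_integral_mult_left)
  moreover have "f (c t) / c t ^ Suc n * (2 * pi * \<i> * c t) * (of_real (r ^ (2 * n)) / (2 * pi * \<i>))
      = f (c t) * cnj (c t ^ n)" for t
  proof -
    have "c t ^ n * cnj (c t ^ n) = of_real (r ^ (2 * n))"
      by (metis c complex_norm_square mult.commute norm_power of_real_power power_mult)
    then have "cnj (c t ^ n) = of_real (r ^ (2 * n)) / c t ^ n"
      using c0[of t] by (simp add: field_simps)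
    then show ?thesis
      using c0[of t] by (simp add: field_simps)
  qed
  ultimately show ?thesis
    by (simp add: c_def)
qed

lemma circle_inner_product_has_integral:
  assumes "f holomorphic_on ball 0 1" "f has_fps_expansion F" "0 < r" "r < 1" "finite I"
  shows "((\<lambda>t. f (circlepath 0 r t) * cnj (\<Sum>n\<in>I. q n * circlepath 0 r t ^ n))
           has_integral (\<Sum>n\<in>I. fps_nth F n * cnj (q n) * of_real (r ^ (2 * n)))) {0..1}"
proof -
  have "((\<lambda>t. \<Sum>n\<in>I. f (circlepath 0 r t) * cnj (circlepath 0 r t ^ n) * cnj (q n)) has_integral
      (\<Sum>n\<in>I. fps_nth F n * of_real (r ^ (2 * n)) * cnj (q n))) {0..1}"
    using assms
    by (intro has_integral_sum has_integral_mult_left circle_coefficient_has_integral) auto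
  then show ?thesis
    by (simp add: sum_distrib_left mult_ac)
qed

lemma has_fps_expansion_polynomial:
  fixes q :: "nat \<Rightarrow> complex"
  assumes "finite I"
  shows "(\<lambda>z. \<Sum>n\<in>I. q n * z ^ n) has_fps_expansion Abs_fps (\<lambda>n. if n \<in> I then q n else 0)"
proof -
  have "(\<lambda>z. \<Sum>n\<in>I. q n * z ^ n) has_fps_expansion (\<Sum>n\<in>I. fps_const (q n) * fps_X ^ n)"
    by (intro fps_expansion_intros)
  also have "(\<Sum>n\<in>I. fps_const (q n) * fps_X ^ n) = Abs_fps (\<lambda>n. if n \<in> I then q n else 0)"
    using assms by (auto simp: fps_eq_iff fps_sum_nth if_distrib sum.delta' cong: if_cong)
  finally show ?thesis .
qed

lemma Re_mult_cnj_of_real: "Re (z * cnj z * of_real x) = (norm z)\<^sup>2 * x"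
  by (metis Re_complex_of_real complex_norm_square of_real_mult)

lemma circle_parseval_polynomial:
  assumes "0 < r" "r < 1" "finite I"
  shows "((\<lambda>t. (norm (\<Sum>n\<in>I. q n * circlepath 0 r t ^ n))\<^sup>2)
           has_integral (\<Sum>n\<in>I. (norm (q n))\<^sup>2 * r ^ (2 * n))) {0..1}"
proof -
  have *: "((\<lambda>t. (\<Sum>n\<in>I. q n * circlepath 0 r t ^ n) * cnj (\<Sum>n\<in>I. q n * circlepath 0 r t ^ n))
      has_integral (\<Sum>n\<in>I. fps_nth (Abs_fps (\<lambda>n. if n \<in> I then q n else 0)) n * cnj (q n) * of_real (r ^ (2 * n)))) {0..1}"
    using assms
    by (intro circle_inner_product_has_integral has_fps_expansion_polynomial holomorphic_intros)
  have "Re (\<Sum>n\<in>I. fps_nth (Abs_fps (\<lambda>n. if n \<in> I then q n else 0)) n * cnj (q n) * of_real (r ^ (2 * n)))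
      = (\<Sum>n\<in>I. (norm (q n))\<^sup>2 * r ^ (2 * n))"
    unfolding Re_sum by (intro sum.cong refl) (simp only: fps_nth_Abs_fps if_True Re_mult_cnj_of_real)
  moreover have "Re (z * cnj z) = (norm z)\<^sup>2" for z
    using Re_mult_cnj_of_real[of z 1] by (simp only: of_real_1 mult_1_right)
  ultimately show ?thesis
    using has_integral_Re[OF *] by (simp only:)
qed

text \<open>With P the part of the series \<open>F\<close> indexed by \<open>I\<close>, the mean of
  Re (f * cnj P) and the mean of |P|^2 both equal the left-hand sum S. Hence the mean of |f - P|^2
  is that of |f|^2 minus S, and it is nonnegative.\<close>

lemma circle_bessel:
  assumes "f holomorphic_on ball 0 1" "f has_fps_expansion F" "0 < r" "r < 1" "finite I"
  shows "(\<Sum>n\<in>I. (norm (fps_nth F n))\<^sup>2 * r ^ (2 * n)) \<le>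
           integral {0..1} (\<lambda>t. (norm (f (circlepath 0 r t)))\<^sup>2)"
proof -
  define c where "c = circlepath 0 r"
  define P where "P = (\<lambda>t. \<Sum>n\<in>I. fps_nth F n * c t ^ n)"
  define S where "S = (\<Sum>n\<in>I. (norm (fps_nth F n))\<^sup>2 * r ^ (2 * n))"
  have "continuous_on {0..1} (\<lambda>t. f (c t))"
  proof (rule continuous_on_compose2[OF holomorphic_on_imp_continuous_on[OF assms(1)]])
    show "continuous_on {0..1} c"
      unfolding c_def circlepath by (intro continuous_intros)
    show "c ` {0..1} \<subseteq> ball 0 1"
      using assms by (auto simp: c_def circlepath norm_mult)
  qed
  then have ff: "((\<lambda>t. (norm (f (c t)))\<^sup>2) has_integral
      integral {0..1} (\<lambda>t. (norm (f (c t)))\<^sup>2)) {0..1}"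
    by (intro integrable_integral integrable_continuous_real continuous_intros)
  have fP: "((\<lambda>t. Re (f (c t) * cnj (P t))) has_integral S) {0..1}"
    using has_integral_Re[OF circle_inner_product_has_integral[OF assms, of "fps_nth F"]]
    unfolding c_def P_def S_def Re_sum Re_mult_cnj_of_real .
  have PP: "((\<lambda>t. (norm (P t))\<^sup>2) has_integral S) {0..1}"
    using circle_parseval_polynomial[OF assms(3-5), of "fps_nth F"] by (simp add: c_def P_def S_def)
  have "((\<lambda>t. (norm (f (c t)))\<^sup>2 - 2 * Re (f (c t) * cnj (P t)) + (norm (P t))\<^sup>2) has_integral
      integral {0..1} (\<lambda>t. (norm (f (c t)))\<^sup>2) - 2 * S + S) {0..1}"
    by (intro has_integral_add has_integral_diff ff PP has_integral_mult_right fP)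
  moreover have "(norm (f (c t)))\<^sup>2 - 2 * Re (f (c t) * cnj (P t)) + (norm (P t))\<^sup>2
      = (norm (f (c t) - P t))\<^sup>2" for t
    unfolding cmod_power2 by (simp add: power2_eq_square algebra_simps)
  ultimately have "((\<lambda>t. (norm (f (c t) - P t))\<^sup>2) has_integral
      integral {0..1} (\<lambda>t. (norm (f (c t)))\<^sup>2) - 2 * S + S) {0..1}"
    by (simp only:)
  then have "0 \<le> integral {0..1} (\<lambda>t. (norm (f (c t)))\<^sup>2) - 2 * S + S"
    by (rule has_integral_nonneg) simp
  then show ?thesis by (simp add: S_def c_def)
qed

section \<open>Clunie's truncation argument\<close>

text \<open>With P the truncation of the series of \<open>D\<close> below degree N, Bessel's
  inequality for w P bounds the coefficients of \<open>A\<close> up to N by the mean of |w P|^2,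
  which is at most the mean of |P|^2 because |w| is at most 1. The integrals involve only w and the
  polynomial P, so expansions at 0 suffice for \<open>A\<close> and \<open>D\<close>.\<close>

lemma clunie_coefficient_inequality:
  assumes w: "w holomorphic_on ball 0 1" "\<And>z. z \<in> ball 0 1 \<Longrightarrow> norm (w z) \<le> 1" "w 0 = 0"
    and A: "A has_fps_expansion FA" and D: "D has_fps_expansion FD"
    and eq: "\<And>z. z \<in> ball 0 1 \<Longrightarrow> A z = w z * D z"
  shows "(\<Sum>n\<le>N. (norm (fps_nth FA n))\<^sup>2) \<le> (\<Sum>n<N. (norm (fps_nth FD n))\<^sup>2)"
proof -
  define W where "W = fps_expansion w 0"
  have W: "w has_fps_expansion W"
    unfolding W_def using w(1) by (intro has_fps_expansion_fps_expansion[of "ball 0 1"]) auto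
  have W0: "fps_nth W 0 = 0"
    using has_fps_expansion_imp_0_eq_fps_nth_0[OF W] w(3) by simp
  have FA: "FA = W * FD"
  proof (rule fps_expansion_unique_complex[OF A])
    have "eventually (\<lambda>z. z \<in> ball 0 1) (nhds (0::complex))"
      by (intro eventually_nhds_in_open) auto
    then have "eventually (\<lambda>z. A z = w z * D z) (nhds 0)"
      by eventually_elim (rule eq)
    then show "A has_fps_expansion W * FD"
      by (rule has_fps_expansion_cong[THEN iffD2, OF _ refl has_fps_expansion_mult[OF W D]])
  qed
  define P where "P = (\<lambda>z. \<Sum>n<N. fps_nth FD n * z ^ n)"
  define G where "G = W * Abs_fps (\<lambda>n. if n < N then fps_nth FD n else 0)"
  have G: "(\<lambda>z. w z * P z) has_fps_expansion G"
    unfolding G_def P_def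
    using has_fps_expansion_mult[OF W has_fps_expansion_polynomial[of "{..<N}" "fps_nth FD"]] by simp
  \<comment> \<open>Since w vanishes at 0, the coefficients of D from index N on do not affect those of A up to N.\<close>
  have GA: "fps_nth G n = fps_nth FA n" if "n \<le> N" for n
    unfolding G_def FA fps_mult_nth
  proof (rule sum.cong[OF refl])
    fix i assume "i \<in> {0..n}"
    then show "fps_nth W i * fps_nth (Abs_fps (\<lambda>n. if n < N then fps_nth FD n else 0)) (n - i)
        = fps_nth W i * fps_nth FD (n - i)"
      using W0 that by (cases "i = 0") auto
  qed
  have hol: "(\<lambda>z. w z * P z) holomorphic_on ball 0 1"
    unfolding P_def by (intro holomorphic_intros w)
  have r: "(\<Sum>n\<le>N. (norm (fps_nth FA n))\<^sup>2 * r ^ (2 * n)) \<le> (\<Sum>n<N. (norm (fps_nth FD n))\<^sup>2 * r ^ (2 * n))"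
    if "0 < r" "r < 1" for r :: real
  proof -
    let ?c = "circlepath 0 r"
    have c: "?c t \<in> ball 0 1" for t
      using that by (auto simp: circlepath norm_mult)
    have cont: "continuous_on {0..1} ?c"
      unfolding circlepath by (intro continuous_intros)
    have PP: "((\<lambda>t. (norm (P (?c t)))\<^sup>2) has_integral (\<Sum>n<N. (norm (fps_nth FD n))\<^sup>2 * r ^ (2 * n))) {0..1}"
      unfolding P_def by (rule circle_parseval_polynomial[OF that]) simp
    have "(\<Sum>n\<le>N. (norm (fps_nth FA n))\<^sup>2 * r ^ (2 * n)) = (\<Sum>n\<le>N. (norm (fps_nth G n))\<^sup>2 * r ^ (2 * n))"
      by (intro sum.cong refl) (simp add: GA)
    also have "\<dots> \<le> integral {0..1} (\<lambda>t. (norm (w (?c t) * P (?c t)))\<^sup>2)"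
      by (rule circle_bessel[OF hol G that]) simp
    also have "\<dots> \<le> integral {0..1} (\<lambda>t. (norm (P (?c t)))\<^sup>2)"
    proof (rule integral_le)
      have "continuous_on {0..1} (\<lambda>t. w (?c t) * P (?c t))"
        using c by (intro continuous_on_compose2[OF holomorphic_on_imp_continuous_on[OF hol] cont]) auto
      then show "(\<lambda>t. (norm (w (?c t) * P (?c t)))\<^sup>2) integrable_on {0..1}"
        by (intro integrable_continuous_real continuous_on_power continuous_on_norm)
      show "(\<lambda>t. (norm (P (?c t)))\<^sup>2) integrable_on {0..1}"
        using PP by blast
      show "(norm (w (?c t) * P (?c t)))\<^sup>2 \<le> (norm (P (?c t)))\<^sup>2" for t
        using w(2)[OF c] by (intro power_mono) (auto simp: norm_mult intro: mult_left_le_one_le)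
    qed
    finally show ?thesis
      using PP by (simp add: integral_unique)
  qed
  \<comment> \<open>Both sides of \<open>r\<close> are polynomials in the radius, so the radius may
    tend to 1 from below.\<close>
  show ?thesis
  proof (rule tendsto_le)
    show "((\<lambda>r. \<Sum>n<N. (norm (fps_nth FD n))\<^sup>2 * r ^ (2 * n)) \<longlongrightarrow> (\<Sum>n<N. (norm (fps_nth FD n))\<^sup>2)) (at_left 1)"
      by (auto intro!: tendsto_eq_intros)
    show "((\<lambda>r. \<Sum>n\<le>N. (norm (fps_nth FA n))\<^sup>2 * r ^ (2 * n)) \<longlongrightarrow> (\<Sum>n\<le>N. (norm (fps_nth FA n))\<^sup>2)) (at_left 1)"
      by (auto intro!: tendsto_eq_intros)
    show "eventually (\<lambda>r. (\<Sum>n\<le>N. (norm (fps_nth FA n))\<^sup>2 * r ^ (2 * n))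
        \<le> (\<Sum>n<N. (norm (fps_nth FD n))\<^sup>2 * r ^ (2 * n))) (at_left 1)"
      by (rule eventually_mono[OF eventually_at_left_real[of 0]]) (auto intro: r)
  qed simp
qed

section \<open>Passage from the exterior disc to the unit disc by inversion\<close>

lemma open_exterior_disc: "open exterior_disc"
  unfolding exterior_disc_def by (intro open_Collect_less continuous_intros)

text \<open>Evaluating the expansion at the real points 1/r with 0 < r < 1 shows that the series of
  b n * r^n converges, and convergence at all these radii determines the bound.\<close>

lemma has_exterior_expansion_conv_radius:
  assumes "has_exterior_expansion g b"
  shows "1 \<le> fps_conv_radius (Abs_fps b)"
  unfolding fps_conv_radius_def fps_nth_Abs_fps
proof (rule conv_radius_geI_ex')
  fix r :: real assume r: "0 < r" "ereal r < 1"
  then have "(\<lambda>n. b n / of_real (1 / r) ^ n) sums (g (of_real (1 / r)) - of_real (1 / r))"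
    using assms unfolding has_exterior_expansion_def exterior_disc_def
    by (simp add: norm_divide del: of_real_divide)
  then show "summable (\<lambda>n. b n * of_real r ^ n)"
    by (auto simp: sums_iff power_divide)
qed

lemma has_exterior_expansion_eval_fps:
  assumes "has_exterior_expansion g b" "z \<in> exterior_disc"
  shows "g z = z + eval_fps (Abs_fps b) (1 / z)"
proof -
  have "(\<lambda>n. b n / z ^ n) sums (g z - z)"
    using assms by (simp add: has_exterior_expansion_def)
  then have "eval_fps (Abs_fps b) (1 / z) = g z - z"
    by (simp add: eval_fps_def sums_iff power_divide)
  then show ?thesis by simp
qed

lemma has_exterior_expansion_deriv:
  assumes "has_exterior_expansion g b" "z \<in> exterior_disc"
  shows "deriv g z = 1 - eval_fps (fps_deriv (Abs_fps b)) (1 / z) / z\<^sup>2"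
proof -
  have z: "z \<noteq> 0" "norm (1 / z) < 1"
    using assms(2) by (auto simp: exterior_disc_def norm_divide divide_less_eq_1)
  then have "ereal (norm (1 / z)) < fps_conv_radius (Abs_fps b)"
    using has_exterior_expansion_conv_radius[OF assms(1)] less_le_trans
    by (metis ereal_less(3))
  then have "((\<lambda>z. z + eval_fps (Abs_fps b) (1 / z)) has_field_derivative
      1 + eval_fps (fps_deriv (Abs_fps b)) (1 / z) * (- (1 / z\<^sup>2))) (at z)"
    using z by (auto intro!: derivative_eq_intros simp: power2_eq_square)
  then have "(g has_field_derivative 1 + eval_fps (fps_deriv (Abs_fps b)) (1 / z) * (- (1 / z\<^sup>2))) (at z)"
    by (rule has_field_derivative_transform_within_open[OF _ open_exterior_disc assms(2)])
       (simp add: has_exterior_expansion_eval_fps[OF assms(1)])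
  then show ?thesis
    by (simp add: DERIV_imp_deriv)
qed

section \<open>The coefficient bound\<close>

text \<open>The points 1 and 2 \<alpha> - 1 are mirror images in the line Re q = \<alpha>, so q is
  nearer to 1 exactly when it lies to the right of that line. Comparing moduli instead of forming a
  quotient avoids the pole at 2 \<alpha> - 1.\<close>

lemma norm_diff_one_less_iff:
  fixes \<alpha> :: real
  assumes "\<alpha> < 1"
  shows "norm (q - 1) < norm (q + of_real (1 - 2 * \<alpha>)) \<longleftrightarrow> \<alpha> < Re q"
proof -
  have "(norm (q + of_real (1 - 2 * \<alpha>)))\<^sup>2 - (norm (q - 1))\<^sup>2 = 4 * (1 - \<alpha>) * (Re q - \<alpha>)"
    unfolding cmod_power2 by (simp add: power2_eq_square algebra_simps)
  then have "(norm (q - 1))\<^sup>2 < (norm (q + of_real (1 - 2 * \<alpha>)))\<^sup>2 \<longleftrightarrow> \<alpha> < Re q"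
    using assms by (smt (verit) mult_pos_pos zero_less_mult_iff)
  then show ?thesis
    by (metis norm_ge_zero power2_less_imp_less power_strict_mono zero_less_numeral)
qed

text \<open>The bounds on n come from Clunie's inequality, where b n sits at degree n + 1: the sum
  up to degree N on the left covers n < N, while the sum below degree N on the right covers the
  constant term and n < N - 1.\<close>

lemma class_Sigma_star_weighted_area:
  assumes "\<alpha> < 1" "g \<in> class_Sigma_star \<alpha>" "has_exterior_expansion g b"
  shows "(\<Sum>n<N. (real n + 1)\<^sup>2 * (norm (b n))\<^sup>2) \<le>
           4 * (1 - \<alpha>)\<^sup>2 + (\<Sum>n<N - 1. (real n - 1 + 2 * \<alpha>)\<^sup>2 * (norm (b n))\<^sup>2)"
proof (cases N)
  case (Suc M)
  define F where "F = Abs_fps b"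
  define B where "B = eval_fps F"
  define B' where "B' = eval_fps (fps_deriv F)"
  \<comment> \<open>With \<zeta> = 1/z these are A = z (\<zeta> g' - g) and D = z (\<zeta> g' + (1 -
    2 \<alpha>) g), taken at \<zeta>. The factor z cancels the pole of g at infinity.\<close>
  define A where "A = (\<lambda>z. - (z * (B z + z * B' z)))"
  define D where "D = (\<lambda>z. of_real (2 * (1 - \<alpha>)) - z\<^sup>2 * B' z + of_real (1 - 2 * \<alpha>) * (z * B z))"
  define w where "w = (\<lambda>z. A z / D z)"
  have rad: "1 \<le> fps_conv_radius F" "1 \<le> fps_conv_radius (fps_deriv F)"
    using has_exterior_expansion_conv_radius[OF assms(3)] fps_conv_radius_deriv[of F]
    unfolding F_def by (auto intro: order.trans)
  have B: "B has_fps_expansion F" "B' has_fps_expansion fps_deriv F"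
    unfolding B_def B'_def
    by (rule eval_fps_has_fps_expansion, rule less_le_trans[OF _ rad(1)], simp)
       (rule eval_fps_has_fps_expansion, rule less_le_trans[OF _ rad(2)], simp)
  have ball: "ball 0 1 \<subseteq> eball (0::complex) (fps_conv_radius F)"
      "ball 0 1 \<subseteq> eball (0::complex) (fps_conv_radius (fps_deriv F))"
    using less_le_trans[OF _ rad(1)] less_le_trans[OF _ rad(2)]
    by (auto simp: eball_def ereal_less(3))
  have holB: "B holomorphic_on ball 0 1" "B' holomorphic_on ball 0 1"
    unfolding B_def B'_def using ball by (auto intro!: holomorphic_on_eval_fps)
  have AD: "norm (A z) < norm (D z)" if z: "z \<in> ball 0 1" for z
  \<comment> \<open>z = 0 stands for infinity, which is not in \<open>exterior_disc\<close>; there A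
    is 0 and D is 2 (1 - \<alpha>).\<close>
  proof (cases "z = 0")
    case True
    then show ?thesis using assms(1) by (simp add: A_def D_def del: of_real_mult of_real_diff)
  next
    case False
    define \<zeta> where "\<zeta> = 1 / z"
    have \<zeta>: "\<zeta> \<in> exterior_disc" "1 / \<zeta> = z"
      using z False by (auto simp: \<zeta>_def exterior_disc_def norm_divide field_simps)
    have g: "g \<zeta> = 1 / z + B z" and dg: "deriv g \<zeta> = 1 - z\<^sup>2 * B' z"
      using has_exterior_expansion_eval_fps[OF assms(3) \<zeta>(1)]
        has_exterior_expansion_deriv[OF assms(3) \<zeta>(1)] \<zeta>(2)
      by (simp_all add: B_def B'_def F_def) (simp_all add: \<zeta>_def power_divide)
    have g0: "g \<zeta> \<noteq> 0" and Re: "\<alpha> < Re (\<zeta> * deriv g \<zeta> / g \<zeta>)"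
      using assms(2) \<zeta>(1) by (auto simp: class_Sigma_star_def)
    define q where "q = \<zeta> * deriv g \<zeta> / g \<zeta>"
    have q: "q * g \<zeta> = 1 / z - z * B' z"
      using g0 False by (simp add: q_def dg) (simp add: \<zeta>_def field_simps power2_eq_square)
    have "A z = (q - 1) * (z * g \<zeta>)"
    proof -
      have "(q - 1) * (z * g \<zeta>) = z * (q * g \<zeta> - g \<zeta>)"
        by (simp add: algebra_simps)
      then show ?thesis
        using False by (simp only: q) (simp add: A_def g algebra_simps)
    qed
    moreover have "D z = (q + of_real (1 - 2 * \<alpha>)) * (z * g \<zeta>)"
    proof -
      have "(q + of_real (1 - 2 * \<alpha>)) * (z * g \<zeta>) = z * (q * g \<zeta> + of_real (1 - 2 * \<alpha>) * g \<zeta>)"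
        by (simp add: algebra_simps)
      then show ?thesis
        using False by (simp only: q) (simp add: D_def g algebra_simps power2_eq_square)
    qed
    moreover have "norm (q - 1) < norm (q + of_real (1 - 2 * \<alpha>))"
      using Re norm_diff_one_less_iff[OF assms(1), of q] by (simp add: q_def)
    ultimately show ?thesis
      using g0 False by (simp add: norm_mult del: of_real_diff)
  qed
  \<comment> \<open>The strict inequality \<open>AD\<close> excludes zeros of D, so w is a genuine
    holomorphic quotient.\<close>
  have D0: "D z \<noteq> 0" if "z \<in> ball 0 1" for z
    using AD[OF that] by auto
  define FA where "FA = - (fps_X * (F + fps_X * fps_deriv F))"
  define FD where "FD = fps_const (of_real (2 * (1 - \<alpha>))) - fps_X\<^sup>2 * fps_deriv F
      + fps_const (of_real (1 - 2 * \<alpha>)) * (fps_X * F)"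
  have "(\<Sum>n\<le>N. (norm (fps_nth FA n))\<^sup>2) \<le> (\<Sum>n<N. (norm (fps_nth FD n))\<^sup>2)"
  proof (rule clunie_coefficient_inequality)
    show "w holomorphic_on ball 0 1"
      unfolding w_def using D0 unfolding A_def D_def
      by (intro holomorphic_intros holB) auto
    show "norm (w z) \<le> 1" if "z \<in> ball 0 1" for z
      using AD[OF that] D0[OF that] by (simp add: w_def norm_divide divide_simps)
    show "w 0 = 0"
      by (simp add: w_def A_def)
    show "A has_fps_expansion FA"
      unfolding A_def FA_def by (intro fps_expansion_intros B)
    show "D has_fps_expansion FD"
      unfolding D_def FD_def by (intro fps_expansion_intros B)
    show "A z = w z * D z" if "z \<in> ball 0 1" for z
      using D0[OF that] by (simp add: w_def)
  qed
  moreover have "fps_nth FA 0 = 0" "fps_nth FD 0 = of_real (2 * (1 - \<alpha>))"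
    by (simp_all add: FA_def FD_def power2_eq_square)
  \<comment> \<open>Applying \<zeta> d/d\<zeta> multiplies the term b n / \<zeta>^n by -n.
    Subtracting g gives the factor -n - 1; adding (1 - 2 \<alpha>) g gives -n + 1 - 2
    \<alpha>.\<close>
  moreover have "fps_nth FA (Suc n) = - (of_real (real n + 1) * b n)" for n
    by (cases n) (auto simp: FA_def F_def algebra_simps)
  moreover have "fps_nth FD (Suc n) = - (of_real (real n - 1 + 2 * \<alpha>) * b n)" for n
    by (cases n) (simp_all add: FD_def F_def fps_X_power_mult_nth, simp_all add: algebra_simps)
  ultimately have "(\<Sum>n<N. (norm (of_real (real n + 1) * b n))\<^sup>2) \<le>
      (norm (of_real (2 * (1 - \<alpha>)) :: complex))\<^sup>2 + (\<Sum>n<M. (norm (of_real (real n - 1 + 2 * \<alpha>) * b n))\<^sup>2)"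
    by (simp only: sum.atMost_shift[of _ N] norm_minus_cancel norm_zero) (simp add: Suc sum.lessThan_Suc_shift del: sum.lessThan_Suc of_real_mult of_real_diff of_real_add)
  then show ?thesis
    by (simp only: norm_mult norm_of_real power_mult_distrib power2_abs Suc diff_Suc_1) simp
qed simp

lemma class_Sigma_star_coefficient_bound:
  assumes "0 \<le> \<alpha>" "\<alpha> < 1" "g \<in> class_Sigma_star \<alpha>" "has_exterior_expansion g b"
  shows "norm (b m) \<le> 2 * (1 - \<alpha>) / (real m + 1)"
proof -
  have "(\<Sum>n<m. (real n + 1)\<^sup>2 * (norm (b n))\<^sup>2) + ((real m + 1) * norm (b m))\<^sup>2
      \<le> 4 * (1 - \<alpha>)\<^sup>2 + (\<Sum>n<m. (real n - 1 + 2 * \<alpha>)\<^sup>2 * (norm (b n))\<^sup>2)"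
    using class_Sigma_star_weighted_area[OF assms(2-4), of "Suc m"] by (simp add: power_mult_distrib)
  \<comment> \<open>Here |n - 1 + 2 \<alpha>| is at most n + 1: the upper estimate uses \<alpha> <
    1, and the lower one, at n = 0, uses 0 \<le> \<alpha>.\<close>
  moreover have "(\<Sum>n<m. (real n - 1 + 2 * \<alpha>)\<^sup>2 * (norm (b n))\<^sup>2) \<le> (\<Sum>n<m. (real n + 1)\<^sup>2 * (norm (b n))\<^sup>2)"
    using assms by (intro sum_mono mult_right_mono) (auto simp flip: abs_le_square_iff)
  ultimately have "((real m + 1) * norm (b m))\<^sup>2 \<le> (2 * (1 - \<alpha>))\<^sup>2"
    by (simp only: power_mult_distrib) simp
  then have "(real m + 1) * norm (b m) \<le> 2 * (1 - \<alpha>)"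
    by (rule power2_le_imp_le) (use assms(2) in simp)
  then show ?thesis
    by (simp add: field_simps)
qed

section \<open>The extremal functions\<close>

text \<open>The Noshiro-Warschawski criterion. Dividing f by b - a makes the derivative along the
  segment from a to b equal to f', so f a = f b would force Re f' = 0 somewhere on it.\<close>

lemma inj_on_Re_deriv_pos:
  assumes "convex S" "\<And>z. z \<in> S \<Longrightarrow> (f has_field_derivative f' z) (at z)"
    and "\<And>z. z \<in> S \<Longrightarrow> 0 < Re (f' z)"
  shows "inj_on f S"
proof (rule inj_onI, rule ccontr)
  fix a b assume ab: "a \<in> S" "b \<in> S" "f a = f b" "a \<noteq> b"
  have seg: "closed_segment a b \<subseteq> S"
    using ab assms(1) by (simp add: closed_segment_subset)
  have "((\<lambda>z. f z / (b - a)) has_field_derivative f' u / (b - a)) (at u)" if "u \<in> closed_segment a b" for u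
    using assms(2) seg that by (auto intro!: DERIV_cdivide)
  from complex_mvt_line[OF this] obtain u where
    "u \<in> closed_segment a b" "Re (f b / (b - a)) - Re (f a / (b - a)) = Re (f' u / (b - a) * (b - a))"
    by blast
  then show False
    using assms(3)[of u] seg ab by auto
qed

text \<open>For this q the quotient (q - 1) / (q + 1 - 2 \<alpha>) is exactly -u, so the half-plane
  criterion applies. Later u is 1 / z^k and q is z g'/g.\<close>

lemma Re_extremal_quotient_gt:
  assumes "norm u < 1" "\<alpha> < 1"
  shows "\<alpha> < Re (1 - of_real (2 * (1 - \<alpha>)) * (u / (1 + u)))"
proof -
  have 0: "1 + u \<noteq> 0"
    using assms by (metis add.inverse_unique add.commute norm_minus_cancel norm_one order.irrefl)
  define q where "q = 1 - of_real (2 * (1 - \<alpha>)) * (u / (1 + u))"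
  have "q - 1 = - (of_real (2 * (1 - \<alpha>)) / (1 + u)) * u"
    by (simp add: q_def)
  moreover have "q + of_real (1 - 2 * \<alpha>) = of_real (2 * (1 - \<alpha>)) / (1 + u)"
    using 0 by (simp add: q_def field_simps)
  ultimately have "norm (q - 1) = norm (q + of_real (1 - 2 * \<alpha>)) * norm u"
      "0 < norm (q + of_real (1 - 2 * \<alpha>))"
    using assms 0 by (simp_all add: norm_mult norm_divide)
  then have "norm (q - 1) < norm (q + of_real (1 - 2 * \<alpha>))"
    using assms by simp
  then show ?thesis
    using norm_diff_one_less_iff[OF assms(2), of q] unfolding q_def by blast
qed

lemma one_plus_not_nonpos: "norm u < 1 \<Longrightarrow> 1 + u \<notin> \<real>\<^sub>\<le>\<^sub>0" for u :: complex
  using abs_Re_le_cmod[of u] by (auto simp: complex_nonpos_Reals_iff)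

text \<open>Since c k = 2 (1 - \<alpha>), the logarithmic derivative z g'/g becomes the quotient
  treated in \<open>Re_extremal_quotient_gt\<close>. The principal power is holomorphic here because
  1 + 1 / z^k stays in the right half plane.\<close>

context
  fixes \<alpha> c :: real and k :: nat and g :: "complex \<Rightarrow> complex"
  assumes \<alpha>: "0 \<le> \<alpha>" "\<alpha> < 1" and k: "0 < k"
  defines "c \<equiv> 2 * (1 - \<alpha>) / real k"
  defines "g \<equiv> \<lambda>z. z * (1 + 1 / z ^ k) powr of_real c"
begin

lemma c_mult_k: "of_real c * of_nat k = (of_real (2 * (1 - \<alpha>)) :: complex)"
  using k by (simp add: c_def)

lemma norm_one_over_power_less_one:
  assumes "z \<in> exterior_disc" shows "norm (1 / z ^ k) < 1"
  using assms k one_less_power[of "norm z" k]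
  by (auto simp: exterior_disc_def norm_divide norm_power divide_less_eq_1)

lemma extremal_has_field_derivative:
  assumes z: "z \<in> exterior_disc"
  shows "(g has_field_derivative g z / z * (1 - of_real (2 * (1 - \<alpha>)) * ((1 / z ^ k) / (1 + 1 / z ^ k)))) (at z)"
proof -
  have z0: "z \<noteq> 0" using z by (auto simp: exterior_disc_def)
  have np: "1 + 1 / z ^ k \<notin> \<real>\<^sub>\<le>\<^sub>0"
    using one_plus_not_nonpos norm_one_over_power_less_one[OF z] by blast
  then have n0: "1 + 1 / z ^ k \<noteq> 0" by force
  have du: "((\<lambda>z. 1 + 1 / z ^ k) has_field_derivative - (of_nat k * (1 / z ^ k) / z)) (at z)"
  proof -
    have "((\<lambda>z. 1 + inverse (z ^ k)) has_field_derivative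
        - (inverse (z ^ k) * (of_nat k * z ^ (k - 1)) * inverse (z ^ k))) (at z)"
      using z0 by (auto intro!: derivative_eq_intros simp: mult_ac)
    moreover have "z ^ (k - 1) = z ^ k / z"
      using k z0 by (simp add: power_diff)
    ultimately show ?thesis
      using z0 by (simp add: divide_inverse[symmetric]) (simp add: divide_inverse mult_ac)
  qed
  have "((\<lambda>z. (1 + 1 / z ^ k) powr of_real c) has_field_derivative
      of_real c * (1 + 1 / z ^ k) powr (of_real c - 1) * - (of_nat k * (1 / z ^ k) / z)) (at z)"
    by (rule DERIV_chain2[OF has_field_derivative_powr[OF np] du])
  then have "(g has_field_derivative (1 + 1 / z ^ k) powr of_real c + z *
      (of_real c * (1 + 1 / z ^ k) powr (of_real c - 1) * - (of_nat k * (1 / z ^ k) / z))) (at z)"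
    unfolding g_def by (rule DERIV_cong[OF DERIV_mult[OF DERIV_ident]]) (simp only: mult_1 mult.commute)
  also have "(1 + 1 / z ^ k) powr of_real c + z *
      (of_real c * (1 + 1 / z ^ k) powr (of_real c - 1) * - (of_nat k * (1 / z ^ k) / z)) =
      g z / z * (1 - of_real c * of_nat k * ((1 / z ^ k) / (1 + 1 / z ^ k)))"
    using z0 n0 by (simp add: g_def powr_diff powr_to_1 right_diff_distrib mult_ac)
  finally show ?thesis
    by (simp only: c_mult_k)
qed

lemma extremal_inj_on: "inj_on g exterior_disc"
proof (rule inj_onI)
  define \<Lambda> where "\<Lambda> = (\<lambda>s. s + of_real c * Ln (1 + exp (- (of_nat k * s))))"
  have small: "norm (exp (- (of_nat k * s))) < 1" if "0 < Re s" for s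
    using that k by simp
  have inj: "inj_on \<Lambda> {s. 0 < Re s}"
  proof (rule inj_on_Re_deriv_pos)
    show "convex {s. 0 < Re s}"
      by (rule convex_halfspace_Re_gt)
    fix s assume s: "s \<in> {s. 0 < Re s}"
    define u where "u = exp (- (of_nat k * s))"
    have u: "norm u < 1" using small s by (simp add: u_def)
    show "(\<Lambda> has_field_derivative (1 - of_real (2 * (1 - \<alpha>)) *
        (exp (- (of_nat k * s)) / (1 + exp (- (of_nat k * s)))))) (at s)"
      unfolding \<Lambda>_def c_mult_k[symmetric]
      using one_plus_not_nonpos[OF u] by (auto intro!: derivative_eq_intros simp: u_def divide_inverse)
    show "0 < Re (1 - of_real (2 * (1 - \<alpha>)) * (exp (- (of_nat k * s)) / (1 + exp (- (of_nat k * s)))))"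
      using Re_extremal_quotient_gt[OF u \<alpha>(2)] \<alpha>(1) unfolding u_def by linarith
  qed
  have g_exp: "g (exp s) = exp (\<Lambda> s)" if "0 < Re s" for s
  proof -
    \<comment> \<open>A nonzero base is required to rewrite \<open>powr\<close> as exp (c * Ln
      base), since \<open>0 powr c\<close> is 0 by convention.\<close>
    have "1 + exp (- (of_nat k * s)) \<noteq> 0"
      using one_plus_not_nonpos[OF small[OF that]] by force
    moreover have "1 / exp s ^ k = exp (- (of_nat k * s))"
      by (simp add: exp_of_nat_mult exp_minus inverse_eq_divide)
    ultimately show ?thesis
      by (simp add: g_def \<Lambda>_def powr_def exp_add)
  qed
  fix x y assume xy: "x \<in> exterior_disc" "y \<in> exterior_disc" "g x = g y"
  define s where "s = Ln x"
  define t where "t = Ln y"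
  have 0: "x \<noteq> 0" "y \<noteq> 0"
    using xy by (auto simp: exterior_disc_def)
  then have st: "exp s = x" "exp t = y" "0 < Re s" "0 < Re t"
    using xy by (auto simp: s_def t_def exterior_disc_def)
  then have "exp (\<Lambda> s) = exp (\<Lambda> t)"
    using g_exp xy(3) by metis
  then obtain n :: int where n: "\<Lambda> s = \<Lambda> t + of_int (2 * n) * pi * \<i>"
    by (auto simp: exp_eq)
  \<comment> \<open>exp (-k s) depends only on exp s because k is an integer, so \<Lambda> commutes
    with translation by multiples of 2 pi i. Shifting t thus absorbs the ambiguity of the logarithm
    and stays in the half plane.\<close>
  define t' where "t' = t + of_int (2 * n) * pi * \<i>"
  have t': "exp t' = exp t"
    unfolding t'_def by (subst exp_eq) blast
  have "exp (- (of_nat k * t')) = exp (- (of_nat k * t))"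
    by (simp add: exp_minus exp_of_nat_mult t')
  then have "\<Lambda> t' = \<Lambda> t + of_int (2 * n) * pi * \<i>"
    by (simp add: \<Lambda>_def) (simp add: t'_def)
  then have "\<Lambda> t' = \<Lambda> s"
    by (simp only: n)
  then have "t' = s"
    using inj st by (auto simp: inj_on_def t'_def)
  then show "x = y"
    using t' st by simp
qed

lemma extremal_expansion:
  "has_exterior_expansion g (\<lambda>j. if k dvd Suc j then of_real c gchoose (Suc j div k) else 0)"
  unfolding has_exterior_expansion_def
proof
  fix z :: complex assume z: "z \<in> exterior_disc"
  have z0: "z \<noteq> 0" using z by (auto simp: exterior_disc_def)
  \<comment> \<open>The binomial series in 1 / z^k, padded with zeros to run over all powers of 1/z.
    The term f 0 = 1 yields the leading z of g; the factor z moves the power i = j + 1 to index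
    j.\<close>
  define f where "f = (\<lambda>i. if k dvd i then (of_real c gchoose (i div k)) / z ^ i else 0)"
  have "(\<lambda>n. (of_real c gchoose n) * (1 / z ^ k) ^ n) sums (1 + 1 / z ^ k) powr of_real c"
    by (rule gen_binomial_complex[OF norm_one_over_power_less_one[OF z]])
  also have "(\<lambda>n. (of_real c gchoose n) * (1 / z ^ k) ^ n) = (\<lambda>n. f (k * n))"
    using k by (simp add: f_def power_mult power_divide)
  also have "(\<lambda>n. f (k * n)) sums (1 + 1 / z ^ k) powr of_real c \<longleftrightarrow> f sums (1 + 1 / z ^ k) powr of_real c"
    by (rule sums_mono_reindex) (use k in \<open>auto simp: strict_mono_def f_def\<close>)
  finally have "(\<lambda>j. f (Suc j)) sums ((1 + 1 / z ^ k) powr of_real c - f 0)"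
    by (simp add: sums_Suc_iff)
  then have "(\<lambda>j. z * f (Suc j)) sums (z * ((1 + 1 / z ^ k) powr of_real c - f 0))"
    by (rule sums_mult)
  moreover have "z * f (Suc j) = (if k dvd Suc j then of_real c gchoose (Suc j div k) else 0) / z ^ j" for j
    using z0 by (simp add: f_def)
  ultimately show "(\<lambda>j. (if k dvd Suc j then of_real c gchoose (Suc j div k) else 0) / z ^ j) sums (g z - z)"
    by (simp add: f_def g_def right_diff_distrib)
qed

lemma extremal_in_class_Sigma_star: "g \<in> class_Sigma_star \<alpha>"
proof -
  have "g analytic_on exterior_disc"
    using extremal_has_field_derivative
    by (auto simp: analytic_on_open open_exterior_disc holomorphic_on_open)
  moreover have "g z \<noteq> 0 \<and> \<alpha> < Re (z * deriv g z / g z)" if z: "z \<in> exterior_disc" for z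
  proof -
    have "z \<noteq> 0" "1 + 1 / z ^ k \<noteq> 0"
      using z one_plus_not_nonpos[OF norm_one_over_power_less_one[OF z]] by (auto simp: exterior_disc_def)
    then have "g z \<noteq> 0" by (simp add: g_def)
    moreover have "z * deriv g z / g z = 1 - of_real (2 * (1 - \<alpha>)) * ((1 / z ^ k) / (1 + 1 / z ^ k))"
      unfolding DERIV_imp_deriv[OF extremal_has_field_derivative[OF z]]
      using \<open>g z \<noteq> 0\<close> \<open>z \<noteq> 0\<close> by simp
    ultimately show ?thesis
      using Re_extremal_quotient_gt[OF norm_one_over_power_less_one[OF z] \<alpha>(2)] by simp
  qed
  ultimately show ?thesis
    using extremal_inj_on extremal_expansion unfolding class_Sigma_star_def class_Sigma_def by blast
qed

end

theorem theorem2: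
  fixes \<alpha> :: real
  assumes "0 \<le> \<alpha>" and "\<alpha> < 1"
  shows "(\<forall>g\<in>class_Sigma_star \<alpha>. \<forall>b. has_exterior_expansion g b \<longrightarrow>
            (\<forall>m::nat. norm (b m) \<le> 2 * (1 - \<alpha>) / (real m + 1))) \<and>
         (\<forall>m::nat. \<exists>g\<in>class_Sigma_star \<alpha>. \<exists>b. has_exterior_expansion g b \<and>
            norm (b m) = 2 * (1 - \<alpha>) / (real m + 1))"
proof (intro conjI allI ballI impI)
  fix g b m assume "g \<in> class_Sigma_star \<alpha>" "has_exterior_expansion g b"
  then show "norm (b m) \<le> 2 * (1 - \<alpha>) / (real m + 1)"
    by (rule class_Sigma_star_coefficient_bound[OF assms])
next
  fix m :: nat
  have "norm (of_real (2 * (1 - \<alpha>) / real (Suc m)) :: complex) = 2 * (1 - \<alpha>) / (real m + 1)"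
    unfolding norm_of_real using assms by simp
  \<comment> \<open>With k = m + 1, index m carries the linear binomial coefficient, which is c
    itself.\<close>
  then have "norm (if Suc m dvd Suc m then of_real (2 * (1 - \<alpha>) / real (Suc m)) gchoose (Suc m div Suc m)
      else 0 :: complex) = 2 * (1 - \<alpha>) / (real m + 1)"
    by (simp only: dvd_refl if_True div_self[OF nat.distinct(2)] gbinomial_1)
  then show "\<exists>g\<in>class_Sigma_star \<alpha>. \<exists>b. has_exterior_expansion g b \<and> norm (b m) = 2 * (1 - \<alpha>) / (real m + 1)"
    using extremal_in_class_Sigma_star[OF assms, of "Suc m"] extremal_expansion[OF assms, of "Suc m"]
    by blast
qed

end
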